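(* Let $A,B\in\mathbb{C}$ with $A\ne B$ and $|B|<1$, and let $\eta\in\mathbb{C}$ be such that $$|\eta|\ge\frac{2|A-B|}{(1-|B|)\tanh 1}.$$ Let $p$ be analytic in $\mathbb{D}$ with $p(0)=1$, satisfying the subordination $$1+\eta\frac{zp'(z)}{p(z)}\prec\frac{1+Az}{1+Bz}.$$ Then $p(z)\prec\cosh\sqrt z$, and $\cosh\sqrt z$ is the best dominant.
   Context: $\mathbb{D}=\{z\in\mathbb{C}:|z|<1\}$. For analytic functions $f,g$ on $\mathbb{D}$, $f\prec g$ means that $f(z)=g(w(z))$ for some analytic $w:\mathbb{D}\to\mathbb{D}$ with $w(0)=0$. The function $\cosh\sqrt z$ denotes the analytic function $\sum_{n=0}^\infty z^n/(2n)!$. A univalent function $q$ on $\mathbb{D}$ is a dominant of a differential subordination if $p\prec q$ for every $p$ satisfying the differential subordination; a dominant $\tilde q$ is the best dominant if $\tilde q\prec q$ for every dominant $q$.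
   Formalization: "Best dominant" is proved for 1+ηzp'/p ≺ 1+ηzq'/q with q=cosh√z, not for the subordination to (1+Az)/(1+Bz): there it is false, since exp(tz) with t=|A-B|/(|η|(1-|B|))<1/2 is a dominant and cosh√z is not subordinate to it. *)

theory Defs
  imports "HOL-Complex_Analysis.Complex_Analysis"
begin

abbreviation unit_disc :: "complex set" (\<open>\<D>\<close>)
  where "\<D> \<equiv> ball 0 1"

definition subordinate :: "(complex \<Rightarrow> complex) \<Rightarrow> (complex \<Rightarrow> complex) \<Rightarrow> bool"  (infix \<open>\<prec>\<close> 50)
  where "f \<prec> g \<longleftrightarrow> f holomorphic_on \<D> \<and> g holomorphic_on \<D> \<and>
    (\<exists>w. w holomorphic_on \<D> \<and> w ` \<D> \<subseteq> \<D> \<and> w 0 = 0 \<and> (\<forall>z\<in>\<D>. f z = g (w z)))"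

definition cosh_sqrt :: "complex \<Rightarrow> complex"
  where "cosh_sqrt z = (\<Sum>n. z ^ n / fact (2 * n))"

definition univalent :: "(complex \<Rightarrow> complex) \<Rightarrow> bool"
  where "univalent q \<longleftrightarrow> q holomorphic_on \<D> \<and> inj_on q \<D>"

(* A differential subordination is represented by the predicate S that says which p satisfy it. *)

definition dominant :: "((complex \<Rightarrow> complex) \<Rightarrow> bool) \<Rightarrow> (complex \<Rightarrow> complex) \<Rightarrow> bool"
  where "dominant S q \<longleftrightarrow> univalent q \<and> (\<forall>p. S p \<longrightarrow> p \<prec> q)"

definition best_dominant :: "((complex \<Rightarrow> complex) \<Rightarrow> bool) \<Rightarrow> (complex \<Rightarrow> complex) \<Rightarrow> bool"
  where "best_dominant S q \<longleftrightarrow> dominant S q \<and> (\<forall>r. dominant S r \<longrightarrow> q \<prec> r)"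

(* The differential subordination 1 + \<eta> z p'(z) / p(z) \<prec> h(z) for normalised analytic p.
   That p has no zero in the disc need not be assumed, although x / 0 = 0: a zero of p other
   than 0 would make the left-hand side unbounded nearby, hence not holomorphic.

   With h(z) = 1 + \<eta> z q'(z) / q(z), q = cosh_sqrt, this is the subordination that q itself solves;
   best dominance of cosh_sqrt refers to it. It cannot refer to h(z) = (1 + A z) / (1 + B z):
   if norm \<eta> \<ge> 2 norm (A - B) / ((1 - norm B) tanh 1), the univalent function exp (t z) with
   t = norm (A - B) / (norm \<eta> (1 - norm B)) < 1/2 is then a dominant, while
   cosh_sqrt \<prec> exp (t z) fails because cosh_sqrt has derivative 1/2 > t at 0. *)
definition diff_subordination ::
    "complex \<Rightarrow> (complex \<Rightarrow> complex) \<Rightarrow> (complex \<Rightarrow> complex) \<Rightarrow> bool"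
  where "diff_subordination \<eta> h p \<longleftrightarrow>
    p holomorphic_on \<D> \<and> p 0 = 1 \<and> (\<lambda>z. 1 + \<eta> * (z * deriv p z / p z)) \<prec> h"

end

theory Submission
  imports Defs
begin

text \<open>
  Let \<open>q = cosh_sqrt\<close>, which is injective and without zeros on the disc of radius 2, and
  \<open>Q z = z * q' z / q z\<close>. If \<open>p \<prec> q\<close> fails, take a point \<open>z\<close> of least modulus where \<open>p\<close> leaves the image of
  the unit disc under \<open>q\<close>; then \<open>p z = q \<zeta>\<close> with \<open>\<bar>\<zeta>\<bar> = 1\<close>, and the Schwarz lemma for the local lift
  of \<open>p\<close> through \<open>q\<close> (Jack's lemma) gives \<open>z * p' z / p z = m * Q \<zeta>\<close> for some real \<open>m \<ge> 1\<close>.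
  Under the first subordination this is impossible because \<open>\<bar>z * p' z / p z\<bar> < tanh 1 / 2\<close>, whereas
  \<open>\<bar>Q\<bar> \<ge> tanh 1 / 2\<close> on the unit circle. Under the subordination solved by \<open>q\<close> itself it is
  impossible because \<open>Q\<close> is starlike, so \<open>m * Q \<zeta>\<close> is not a value of \<open>Q\<close> in the open disc.
\<close>

section \<open>The entire function \<open>cosh_sqrt\<close>: zeros, injectivity, logarithmic
  derivative\<close>

lemma cosh_sqrt_sums_cosh:
  fixes a :: complex
  shows "(\<lambda>n. (a\<^sup>2) ^ n / fact (2 * n)) sums cosh a"
proof -
  have "(\<lambda>n. if even (2 * n) then a ^ (2 * n) /\<^sub>R fact (2 * n) else 0) sums cosh a"
    using cosh_converges[of a]
    by (subst sums_mono_reindex[of "(*) 2" "\<lambda>n. if even n then a ^ n /\<^sub>R fact n else 0"])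
       (auto simp: strict_mono_def)
  then show ?thesis
    by (simp add: scaleR_conv_of_real divide_inverse mult.commute flip: power_mult)
qed

lemma cosh_sqrt_power2: "cosh_sqrt (a\<^sup>2) = cosh a"
  using cosh_sqrt_sums_cosh[of a] by (simp add: cosh_sqrt_def sums_iff)

lemma cosh_sqrt_sums: "(\<lambda>n. z ^ n / fact (2 * n)) sums cosh_sqrt z"
  using cosh_sqrt_sums_cosh[of "csqrt z"] cosh_sqrt_power2[of "csqrt z"] by simp

lemma cosh_sqrt_0 [simp]: "cosh_sqrt 0 = 1"
  using cosh_sqrt_power2[of 0] by simp

lemma holomorphic_cosh_sqrt [holomorphic_intros]: "cosh_sqrt holomorphic_on S"
proof -
  have "cosh_sqrt holomorphic_on ball 0 r" for r
    by (rule power_series_holomorphic[where a = "\<lambda>n. 1 / fact (2 * n)"])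
       (use cosh_sqrt_sums in simp)
  then have "cosh_sqrt field_differentiable at z" for z
    using holomorphic_on_imp_differentiable_at[of cosh_sqrt "ball 0 (norm z + 1)" z] by simp
  then show ?thesis
    by (simp add: holomorphic_on_def field_differentiable_at_within)
qed

text \<open>The zeros are \<open>- ((n + 1/2) * pi)^2\<close>, the nearest at distance
  \<open>pi^2 / 4 > 2\<close>; already \<open>pi \<ge> 3\<close> gives distance at least
  9/4.\<close>

lemma cosh_sqrt_nonzero:
  assumes "norm z < 2"
  shows "cosh_sqrt z \<noteq> 0"
proof
  assume "cosh_sqrt z = 0"
  then have "cos (\<i> * csqrt z) = 0"
    using cosh_sqrt_power2[of "csqrt z"] by (simp add: cosh_conv_cos)
  then obtain n :: int where "\<i> * csqrt z = complex_of_real (n * pi) + of_real pi / 2"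
    using cos_eq_0 by blast
  then have "\<i> * csqrt z = of_real ((of_int n + 1 / 2) * pi)"
    by (simp add: algebra_simps)
  then have "norm (csqrt z) = \<bar>of_int n + 1 / 2\<bar> * pi"
    by (metis norm_mult norm_ii mult_1 norm_of_real abs_mult abs_of_pos pi_gt_zero)
  moreover have "\<bar>of_int n + 1 / 2\<bar> \<ge> (1 / 2 :: real)"
  proof (cases "n \<ge> 0")
    case False
    then have "n \<le> -1" by simp
    then have "real_of_int n \<le> -1" by linarith
    then show ?thesis by linarith
  qed simp
  ultimately have "norm (csqrt z) \<ge> 1 / 2 * pi"
    by (metis mult_right_mono pi_ge_zero)
  moreover have "pi \<ge> 3" using pi_approx(1) by simp
  ultimately have "norm (csqrt z) \<ge> 3 / 2" by linarith
  then have "(norm (csqrt z))\<^sup>2 \<ge> (3 / 2)\<^sup>2" by (intro power_mono) auto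
  then show False using assms by (simp add: power2_eq_square flip: norm_mult)
qed

text \<open>If \<open>cosh a = cosh b\<close>, then \<open>a = b\<close> or \<open>a = - b\<close>
  up to a multiple of \<open>2 * pi * \<i>\<close>. Square roots of points of this disc have modulus
  below 3/2, so the multiple is zero, and both signs give the same square.\<close>

lemma inj_on_cosh_sqrt: "inj_on cosh_sqrt (ball 0 2)"
proof (rule inj_onI)
  fix x y assume xy: "x \<in> ball 0 2" "y \<in> ball 0 2" "cosh_sqrt x = cosh_sqrt y"
  have less: "norm (csqrt z) < 3 / 2" if "z \<in> ball 0 2" for z
  proof (rule ccontr)
    assume "\<not> ?thesis"
    then have "(norm (csqrt z))\<^sup>2 \<ge> (3 / 2)\<^sup>2" by (intro power_mono) auto
    then show False using that by (simp add: power2_eq_square flip: norm_mult)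
  qed
  have "cos (\<i> * csqrt x) = cos (\<i> * csqrt y)"
    using xy cosh_sqrt_power2[of "csqrt x"] cosh_sqrt_power2[of "csqrt y"]
    by (simp add: cosh_conv_cos)
  then obtain n where n: "n \<in> \<int>"
    "\<i> * csqrt x = \<i> * csqrt y + of_real (2 * n * pi) \<or> \<i> * csqrt x = - (\<i> * csqrt y) + of_real (2 * n * pi)"
    using complex_cos_eq by blast
  then have "norm (complex_of_real (2 * n * pi)) \<le> norm (\<i> * csqrt x) + norm (\<i> * csqrt y)"
    by (metis norm_triangle_ineq norm_triangle_ineq4 add_diff_cancel_left' minus_add_cancel add.commute diff_minus_eq_add)
  also have "\<dots> < 3"
    using less[OF xy(1)] less[OF xy(2)] by (simp add: norm_mult)
  finally have "2 * pi * \<bar>n\<bar> < 3"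
    by (simp add: norm_mult abs_mult mult_ac)
  moreover have "n = 0 \<or> \<bar>n\<bar> \<ge> 1" using n(1) Ints_nonzero_abs_ge1 by blast
  moreover have "pi \<ge> 3" using pi_approx(1) by simp
  ultimately have "n = 0"
    using mult_left_mono[of 1 "\<bar>n\<bar>" "2 * pi"] by linarith
  then have "csqrt x = csqrt y \<or> csqrt x = - csqrt y"
    using n(2) by (metis add.right_neutral complex_i_not_zero mult_cancel_left mult_minus_right mult_zero_left mult_zero_right of_real_0)
  then show "x = y" by (metis power2_csqrt power2_minus)
qed

lemma univalent_cosh_sqrt: "univalent cosh_sqrt"
  unfolding univalent_def
  by (meson holomorphic_cosh_sqrt inj_on_cosh_sqrt inj_on_subset subset_ball one_le_numeral)

lemma deriv_cosh_sqrt_nonzero: "norm z < 2 \<Longrightarrow> deriv cosh_sqrt z \<noteq> 0"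
  using holomorphic_injective_imp_regular[OF holomorphic_cosh_sqrt open_ball inj_on_cosh_sqrt] by simp

lemma deriv_cosh_sqrt_power2: "2 * a * deriv cosh_sqrt (a\<^sup>2) = sinh a"
proof -
  have "(cosh_sqrt has_field_derivative deriv cosh_sqrt (a\<^sup>2)) (at (a\<^sup>2))"
    using holomorphic_cosh_sqrt[of UNIV] holomorphic_derivI by blast
  then have "((\<lambda>a. cosh_sqrt (a\<^sup>2)) has_field_derivative deriv cosh_sqrt (a\<^sup>2) * (2 * a)) (at a)"
    by (rule DERIV_chain2) (auto intro!: derivative_eq_intros)
  moreover have "((\<lambda>a. cosh_sqrt (a\<^sup>2)) has_field_derivative sinh a) (at a)"
    unfolding cosh_sqrt_power2 by (auto intro!: derivative_eq_intros)
  ultimately show ?thesis using DERIV_unique by (metis mult.commute)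
qed

lemma log_deriv_cosh_sqrt_power2:
  "a\<^sup>2 * deriv cosh_sqrt (a\<^sup>2) / cosh_sqrt (a\<^sup>2) = a * tanh a / 2"
  unfolding tanh_def cosh_sqrt_power2 deriv_cosh_sqrt_power2[of a, symmetric]
  by (simp add: power2_eq_square)

subsection \<open>Estimates for hyperbolic functions\<close>

text \<open>Convexity of sinh with \<open>sinh 0 = 0\<close>, read off termwise: only odd powers
  occur, and \<open>t ^ n \<le> t\<close> for odd \<open>n\<close>.\<close>

lemma sinh_mult_le:
  fixes t c :: real
  assumes "0 \<le> t" "t \<le> 1" "0 \<le> c"
  shows "sinh (t * c) \<le> t * sinh c"
proof (rule sums_le[OF _ sinh_converges sums_mult[OF sinh_converges]])
  fix n show "(if even n then 0 else (t * c) ^ n /\<^sub>R fact n) \<le> t * (if even n then 0 else c ^ n /\<^sub>R fact n)"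
  proof (cases "even n")
    case False
    then have "t ^ n \<le> t" using assms power_decreasing[of 1 n t] by (cases n) auto
    then have "t ^ n * (c ^ n / fact n) \<le> t * (c ^ n / fact n)"
      using assms by (intro mult_right_mono) auto
    then show ?thesis using False
      by (simp add: power_mult_distrib divide_inverse mult_ac)
  qed simp
qed

text \<open>Without its linear term the sinh series still has nonnegative coefficients, so the
  triangle inequality applies termwise.\<close>

lemma norm_sinh_minus_le:
  fixes u :: complex
  shows "norm (sinh u - u) \<le> sinh (norm u) - norm u"
proof -
  have *: "(\<lambda>n. (if even n then 0 else x ^ n /\<^sub>R fact n) - (if n = 1 then x else 0)) sums (sinh x - x)"
    for x :: "'b :: {real_normed_field,banach}"
    using sums_diff[OF sinh_converges[of x] sums_single[of 1 "\<lambda>_. x"]] by simp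
  show ?thesis
    by (rule norm_sums_le[OF * *]) (auto simp: norm_power norm_divide)
qed

lemma sinh_2_less_4: "sinh 2 < (4::real)"
proof -
  have "exp 1 ^ 2 < (272 / 100 :: real) ^ 2"
    by (rule power_strict_mono[OF e_less_272]) auto
  then have "exp 2 < (8::real)"
    by (simp add: power2_eq_square flip: exp_add)
  moreover have "sinh 2 < exp 2 / (2::real)" by (simp add: sinh_field_def)
  ultimately show ?thesis by linarith
qed

text \<open>Convexity reduces \<open>sinh r < 2 * r\<close> for \<open>0 < r \<le> 2\<close> to the
  endpoint \<open>sinh 2 < 4\<close>.\<close>

lemma norm_sinh_minus_less:
  fixes u :: complex
  assumes "u \<noteq> 0" "norm u \<le> 2"
  shows "norm (sinh u - u) < norm u"
proof -
  have "sinh (norm u) \<le> norm u / 2 * sinh 2"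
    using sinh_mult_le[of "norm u / 2" 2] assms by simp
  also have "\<dots> < norm u / 2 * 4"
    using assms sinh_2_less_4 by (intro mult_strict_left_mono) auto
  finally show ?thesis using norm_sinh_minus_le[of u] by linarith
qed

text \<open>\<open>sinh u / u\<close> lies in the open disc of radius 1 about 1, hence in the right
  half-plane, which inversion preserves.\<close>

lemma Re_div_sinh_pos:
  fixes u :: complex
  assumes "u \<noteq> 0" "norm u \<le> 2"
  shows "sinh u \<noteq> 0" "Re (u / sinh u) > 0"
proof -
  have *: "norm (sinh u / u - 1) < 1"
    using norm_sinh_minus_less[OF assms] assms
    by (simp add: divide_diff_eq_iff norm_divide)
  then show "sinh u \<noteq> 0" by auto
  have "Re (1 - sinh u / u) < 1"
    using * complex_Re_le_cmod[of "1 - sinh u / u"] by (simp add: norm_minus_commute)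
  then have "Re (sinh u / u) > 0" by simp
  then show "Re (u / sinh u) > 0"
    unfolding Re_complex_div_gt_0 by (simp add: mult.commute)
qed

text \<open>By convexity of sinh, \<open>cosh (2 * x) - x^2 * sinh 2\<close> is nonincreasing on
  [0, 1]; compare with its value at 1.\<close>

lemma cosh_double_arg_ge:
  fixes x :: real
  assumes "0 \<le> x" "x \<le> 1"
  shows "cosh (2 * x) \<ge> cosh 2 - (1 - x\<^sup>2) * sinh 2"
proof -
  have "((\<lambda>x. cosh (2 * x) - x\<^sup>2 * sinh 2) has_real_derivative 2 * sinh (2 * y) - 2 * y * sinh 2) (at y)" for y
    by (auto intro!: derivative_eq_intros)
  moreover have "2 * sinh (2 * y) - 2 * y * sinh 2 \<le> 0" if "x \<le> y" "y \<le> 1" for y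
    using sinh_mult_le[of y 2] that assms by (simp add: mult.commute)
  ultimately have "cosh (2 * 1) - 1\<^sup>2 * sinh 2 \<le> cosh (2 * x) - x\<^sup>2 * sinh 2"
    using DERIV_nonpos_imp_nonincreasing[of x 1 "\<lambda>x. cosh (2 * x) - x\<^sup>2 * sinh 2"] assms by blast
  then show ?thesis by (simp add: algebra_simps)
qed

lemma cos_le_quartic: "cos (x::real) \<le> 1 - x\<^sup>2 / 2 + x ^ 4 / 24"
proof -
  obtain t where t: "cos x = (\<Sum>m<4. cos_coeff m * x ^ m) + (cos (t + 1/2 * real 4 * pi) / fact 4) * x ^ 4"
    using Maclaurin_cos_expansion[of x 4] by blast
  have "cos (t + 1/2 * real 4 * pi) / fact 4 * x ^ 4 \<le> 1 / fact 4 * x ^ 4"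
    by (intro mult_right_mono divide_right_mono) auto
  moreover have "(\<Sum>m<4. cos_coeff m * x ^ m) = 1 - x\<^sup>2 / 2"
    by (simp add: lessThan_nat_numeral cos_coeff_def)
  ultimately show ?thesis using t by (simp add: fact_numeral)
qed

lemma norm_sinh_squared: "norm (sinh a) ^ 2 = (cosh (2 * Re a) - cos (2 * Im a)) / 2" for a :: complex
  using norm_sin_squared[of "\<i> * a"] by (simp add: sinh_conv_sin norm_mult cosh_field_def exp_minus field_simps)

lemma norm_cosh_squared: "norm (cosh a) ^ 2 = (cosh (2 * Re a) + cos (2 * Im a)) / 2" for a :: complex
proof -
  have "norm (cosh a) ^ 2 = cos (Im a) ^ 2 + sinh (Re a) ^ 2"
    using norm_cos_squared[of "\<i> * a"]
    by (simp add: cosh_conv_cos sinh_field_def exp_minus power_divide)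
  then show ?thesis
    using cos_double_cos[of "Im a"] cosh_double[of "Re a"] cosh_square_eq[of "Re a"] by simp
qed

text \<open>Squaring and cross-multiplying reduces the claim to
  \<open>cosh 2 * cos (2 * y) \<le> cosh (2 * x)\<close> on the circle. Both sides are compared with
  \<open>cosh 2 - y^2 * sinh 2\<close>.\<close>

lemma norm_tanh_ge:
  fixes a :: complex
  assumes "norm a = 1"
  shows "norm (tanh a) \<ge> tanh 1"
proof -
  define x y where "x = \<bar>Re a\<bar>" and "y = Im a"
  have xy: "x\<^sup>2 + y\<^sup>2 = 1" using assms by (simp add: x_def y_def norm_complex_def)
  have x: "0 \<le> x" "x \<le> 1" using abs_Re_le_cmod[of a] assms by (auto simp: x_def)
  have c: "cosh (2 * Re a) = cosh (2 * x)"
    unfolding x_def by (metis cosh_real_abs abs_mult abs_numeral)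
  have "cos (2 * y) \<le> 1 - 2 * y\<^sup>2 + 2 / 3 * (y\<^sup>2)\<^sup>2"
    using cos_le_quartic[of "2 * y"] by (simp add: power_mult_distrib flip: power_mult)
  moreover have "y\<^sup>2 \<le> 1" using xy zero_le_power2[of x] by linarith
  then have "(y\<^sup>2)\<^sup>2 \<le> y\<^sup>2"
    using mult_left_le[of "y\<^sup>2" "y\<^sup>2"] by (simp add: power2_eq_square[of "y\<^sup>2"])
  \<comment> \<open>As \<open>y^2 \<le> 1\<close>, the quartic term costs at most
    \<open>2 / 3 * y^2\<close>, leaving even \<open>1 - 4 / 3 * y^2\<close>.\<close>
  ultimately have "cos (2 * y) \<le> 1 - y\<^sup>2"
    using zero_le_power2[of y] by linarith
  then have "cosh 2 * cos (2 * y) \<le> cosh 2 * (1 - y\<^sup>2)"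
    by (intro mult_left_mono) auto
  also have "\<dots> \<le> cosh 2 - y\<^sup>2 * sinh 2"
    using mult_left_mono[OF sinh_le_cosh_real[of 2], of "y\<^sup>2"] by (simp add: algebra_simps)
  also have "\<dots> \<le> cosh (2 * x)"
    using cosh_double_arg_ge[OF x] xy by (simp add: eq_diff_eq[symmetric] add.commute)
  finally have key: "cosh 2 * cos (2 * y) \<le> cosh (2 * x)" .
  have "norm (cosh a) > 0"
    using cosh_sqrt_nonzero[of "a\<^sup>2"] assms by (simp add: cosh_sqrt_power2 norm_power)
  have "(norm (cosh a) * sinh 1)\<^sup>2 \<le> (norm (sinh a) * cosh 1)\<^sup>2"
    using key cosh_double[of "1::real"] cosh_square_eq[of "1::real"]
    unfolding power_mult_distrib norm_sinh_squared norm_cosh_squared c y_def[symmetric]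
    by (simp add: field_simps)
  then have "norm (cosh a) * sinh 1 \<le> norm (sinh a) * cosh 1"
    by (rule power2_le_imp_le) simp
  then show ?thesis using \<open>norm (cosh a) > 0\<close>
    by (simp add: tanh_def norm_divide field_simps)
qed

subsection \<open>Contact on the boundary\<close>

text \<open>Jack's lemma. The Schwarz bound \<open>norm (W (z * z0)) \<le> norm z\<close> is an
  equality at \<open>z = 1\<close>; moving from there into the disc in direction \<open>d\<close>
  bounds \<open>Re (D * d)\<close> by \<open>Re d\<close>, with \<open>D\<close> the logarithmic
  derivative. Varying \<open>d\<close> makes \<open>D\<close> real and at least 1.\<close>

lemma boundary_Schwarz_derivative:
  assumes W: "W holomorphic_on U" "open U" and U: "ball 0 (norm z0) \<subseteq> U" "z0 \<in> U"
    and W0: "W 0 = 0" and less: "W ` ball 0 (norm z0) \<subseteq> ball 0 1" and eq: "norm (W z0) = 1"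
  obtains m :: real where "m \<ge> 1" "z0 * deriv W z0 = of_real m * W z0"
proof -
  have z0: "z0 \<noteq> 0" using W0 eq by auto
  have Wz0: "W z0 \<noteq> 0" using eq by auto
  have ball: "z * z0 \<in> ball 0 (norm z0)" if "norm z < 1" for z
    using that z0 by (simp add: norm_mult)
  have Schwarz: "norm (W (z * z0)) \<le> norm z" if "norm z < 1" for z
  proof (rule Schwarz_Lemma(1)[of "\<lambda>z. W (z * z0)"])
    have "W \<circ> (\<lambda>z. z * z0) holomorphic_on ball 0 1"
      by (rule holomorphic_on_compose_gen[OF _ W(1)])
         (use ball U(1) in \<open>auto intro!: holomorphic_intros\<close>)
    then show "(\<lambda>z. W (z * z0)) holomorphic_on ball 0 1" by (simp add: o_def)
  next
    fix z :: complex assume "norm z < 1"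
    then show "norm (W (z * z0)) < 1" using less ball[of z] by (force simp: image_subset_iff)
  qed (use W0 that in auto)
  define D where "D = z0 * deriv W z0 / W z0"
  \<comment> \<open>Compare \<open>Re (W (z * z0) / W z0) \<le> norm z\<close> to first order along \<open>z = 1 + t * d\<close>, with
    \<open>norm z \<le> (1 + (norm z)\<^sup>2) / 2\<close> to avoid differentiating the norm.\<close>
  have dir: "Re (D * d) \<le> Re d" if d: "Re d < 0" for d
  proof (rule ccontr)
    assume neg: "\<not> ?thesis"
    define g where "g t = 1 + t * Re d + t\<^sup>2 * (norm d)\<^sup>2 / 2 - Re (W ((1 + of_real t * d) * z0) / W z0)" for t
    have "(W has_field_derivative deriv W z0) (at ((1 + 0 * d) * z0))"
      using holomorphic_derivI[OF W U(2)] by simp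
    then have "((\<lambda>t. W ((1 + t * d) * z0)) has_field_derivative deriv W z0 * (d * z0)) (at 0)"
      by (rule DERIV_chain2) (auto intro!: derivative_eq_intros)
    then have "((\<lambda>t. W ((1 + t * d) * z0) / W z0) has_field_derivative D * d) (at (of_real 0))"
      using DERIV_cdivide[of _ _ "0::complex" UNIV "W z0"] by (simp add: D_def mult_ac)
    then have "((\<lambda>t. W ((1 + of_real t * d) * z0) / W z0) has_vector_derivative D * d) (at 0)"
      by (rule has_vector_derivative_real_field)
    then have "((\<lambda>t. Re (W ((1 + of_real t * d) * z0) / W z0)) has_real_derivative Re (D * d)) (at 0)"
      by (rule has_field_derivative_Re)
    moreover have "((\<lambda>t. 1 + t * Re d + t\<^sup>2 * (norm d)\<^sup>2 / 2) has_real_derivative Re d) (at 0)"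
      by (auto intro!: derivative_eq_intros)
    ultimately have "(g has_real_derivative Re d - Re (D * d)) (at 0)"
      unfolding g_def by (rule DERIV_diff[rotated])
    from DERIV_neg_dec_right[OF this] neg obtain \<epsilon> where
      \<epsilon>: "\<epsilon> > 0" "\<And>h. 0 < h \<Longrightarrow> h < \<epsilon> \<Longrightarrow> g h < g 0" by auto
    have "norm d > 0" using d by auto
    \<comment> \<open>The first bound gives \<open>g t < g 0\<close>; the second keeps
      \<open>1 + t * d\<close> inside the unit disc.\<close>
    define t where "t = min (\<epsilon> / 2) (- Re d / (norm d)\<^sup>2)"
    have t: "t > 0" "t < \<epsilon>" using \<epsilon>(1) d \<open>norm d > 0\<close> by (auto simp: t_def divide_neg_pos)
    have "t * (norm d)\<^sup>2 \<le> - Re d"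
      using \<open>norm d > 0\<close> by (simp add: t_def min_mult_distrib_right)
    then have td: "t * (t * (norm d)\<^sup>2) \<le> t * (- Re d)" using t by (intro mult_left_mono) auto
    have n2: "(norm (1 + of_real t * d))\<^sup>2 = 1 + 2 * t * Re d + t\<^sup>2 * (norm d)\<^sup>2"
      unfolding cmod_power2 by (simp add: power2_eq_square algebra_simps)
    have "t * Re d < 0" using t d by (simp add: mult_pos_neg)
    then have "(norm (1 + of_real t * d))\<^sup>2 < 1\<^sup>2"
      unfolding n2 using td by (simp add: power2_eq_square algebra_simps)
    then have "norm (1 + of_real t * d) < 1" by (rule power2_less_imp_less) simp
    from Schwarz[OF this] have "Re (W ((1 + of_real t * d) * z0) / W z0) \<le> norm (1 + of_real t * d)"
      using complex_Re_le_cmod[of "W ((1 + of_real t * d) * z0) / W z0"] eq by (simp add: norm_divide)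
    also have "\<dots> \<le> (1 + (norm (1 + of_real t * d))\<^sup>2) / 2"
      using zero_le_power2[of "norm (1 + of_real t * d) - 1"] by (simp add: power2_diff)
    finally have "g t \<ge> 0" unfolding n2 g_def by (simp add: field_simps)
    moreover have "g 0 = 0" using Wz0 by (simp add: g_def)
    ultimately show False using \<epsilon>(2)[OF t] by simp
  qed
  have D: "Re D + y * Im D \<ge> 1" for y
    using dir[of "Complex (- 1) y"] by (simp add: algebra_simps)
  \<comment> \<open>A nonzero \<open>Im D\<close> would allow a \<open>y\<close> making the left
    side of \<open>D\<close> vanish.\<close>
  have "Im D = 0" using D[of "- Re D / Im D"] by (cases "Im D = 0") auto
  then have "D = of_real (Re D)" by (simp add: complex_eq_iff)
  then have "z0 * deriv W z0 = of_real (Re D) * W z0" using Wz0 by (simp add: D_def field_simps)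
  then show thesis using that D[of 0] by simp
qed

text \<open>The room \<open>R > 1\<close> makes the inverse of \<open>q\<close> holomorphic near
  \<open>q \<zeta>\<close> for \<open>\<zeta>\<close> on the unit circle, so the lift of
  \<open>p\<close> is differentiable at the first exit point.\<close>

lemma subordinate_if_no_boundary_contact:
  assumes p: "p holomorphic_on ball 0 1" and q: "q holomorphic_on ball 0 R" "inj_on q (ball 0 R)"
    and R: "1 < R" and pq: "p 0 = q 0"
    and no_contact: "\<And>z \<zeta> m. norm z < 1 \<Longrightarrow> norm \<zeta> = 1 \<Longrightarrow> m \<ge> 1 \<Longrightarrow> p z = q \<zeta> \<Longrightarrow>
      z * deriv p z \<noteq> of_real m * (\<zeta> * deriv q \<zeta>)"
  shows "subordinate p q"
proof -
  obtain g where g: "g holomorphic_on q ` ball 0 R" "\<And>z. z \<in> ball 0 R \<Longrightarrow> g (q z) = z"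
    using holomorphic_has_inverse[OF q(1) open_ball q(2)] by metis
  have sub: "ball 0 1 \<subseteq> ball (0::complex) R" using R by (simp add: subset_ball)
  have q1: "q holomorphic_on ball 0 1" using q(1) sub holomorphic_on_subset by blast
  have o1: "open (q ` ball 0 1)"
    using open_mapping_thm3[OF q1 open_ball] q(2) sub inj_on_subset by blast
  have oR: "open (q ` ball 0 R)" using open_mapping_thm3[OF q(1) open_ball q(2)] .
  have pc: "continuous_on (ball 0 1) p" using p by (rule holomorphic_on_imp_continuous_on)
  have "p ` ball 0 1 \<subseteq> q ` ball 0 1"
  proof (rule ccontr)
    assume "\<not> ?thesis"
    then obtain z1 where z1: "norm z1 < 1" "p z1 \<notin> q ` ball 0 1" by (auto simp: image_subset_iff)
    define K where "K = cball 0 (norm z1) \<inter> p -` (- (q ` ball 0 1))"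
    have "closed K" unfolding K_def
      by (rule continuous_closed_preimage)
         (use z1 o1 in \<open>auto intro: continuous_on_subset[OF pc] simp: closed_Compl\<close>)
    then have "compact K" unfolding K_def by (metis bounded_Int bounded_cball compact_eq_bounded_closed)
    moreover have "z1 \<in> K" using z1 by (simp add: K_def)
    ultimately obtain z0 where z0: "z0 \<in> K" "\<And>z. z \<in> K \<Longrightarrow> norm z0 \<le> norm z"
      using continuous_attains_inf[of K norm] continuous_on_norm_id by blast
    have z0_less: "norm z0 < 1" using z0(1) z1(1) by (simp add: K_def)
    have inside: "p z \<in> q ` ball 0 1" if "z \<in> ball 0 (norm z0)" for z
      using z0(2)[of z] z0(1) that by (fastforce simp: K_def)
    have "p z0 \<notin> q ` ball 0 1" using z0(1) by (simp add: K_def)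
    then have "z0 \<noteq> 0" using pq by force
    \<comment> \<open>\<open>p z0\<close> is a limit of values of \<open>q\<close> on the open disc,
      and the image of the closed disc is compact.\<close>
    have "p z0 \<in> q ` cball 0 1"
    proof -
      have "closed (q ` cball 0 1)"
        using R holomorphic_on_imp_continuous_on[OF q(1)]
        by (intro compact_imp_closed compact_continuous_image) (auto intro: continuous_on_subset)
      moreover have "z0 \<in> closure (ball 0 (norm z0))" using \<open>z0 \<noteq> 0\<close> by simp
      moreover have "continuous_on (closure (ball 0 (norm z0))) p"
        using \<open>z0 \<noteq> 0\<close> z0_less by (auto intro: continuous_on_subset[OF pc])
      moreover have "p ` ball 0 (norm z0) \<subseteq> q ` cball 0 1" using inside by force
      ultimately show ?thesis using image_closure_subset by blast
    qed
    then obtain \<zeta> where \<zeta>: "norm \<zeta> \<le> 1" "p z0 = q \<zeta>" by auto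
    with \<open>p z0 \<notin> q ` ball 0 1\<close> have \<zeta>1: "norm \<zeta> = 1" by force
    define U where "U = ball 0 1 \<inter> p -` (q ` ball 0 R)"
    have "open U" unfolding U_def by (rule continuous_open_preimage[OF pc open_ball oR])
    have "(g \<circ> p) holomorphic_on U"
      by (rule holomorphic_on_compose_gen[OF holomorphic_on_subset[OF p] g(1)]) (auto simp: U_def)
    moreover have "ball 0 (norm z0) \<subseteq> U" using inside sub z0_less by (fastforce simp: U_def)
    moreover have "z0 \<in> U" using z0_less \<zeta> R by (force simp: U_def)
    moreover have "(g \<circ> p) 0 = 0" using pq g(2)[of 0] R by simp
    moreover have "(g \<circ> p) ` ball 0 (norm z0) \<subseteq> ball 0 1" using inside sub g(2) by fastforce
    moreover have gz0: "(g \<circ> p) z0 = \<zeta>" using \<zeta> g(2)[of \<zeta>] R by simp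
    ultimately obtain m where m: "m \<ge> 1" "z0 * deriv (g \<circ> p) z0 = of_real m * \<zeta>"
      using boundary_Schwarz_derivative[of "g \<circ> p" U z0] \<open>open U\<close> \<zeta>1 by metis
    \<comment> \<open>Differentiating \<open>p = q \<circ> (g \<circ> p)\<close> transfers the
      relation at \<open>z0\<close> from the lift to \<open>p\<close>.\<close>
    have "(g \<circ> p has_field_derivative deriv (g \<circ> p) z0) (at z0)"
      using \<open>(g \<circ> p) holomorphic_on U\<close> \<open>open U\<close> \<open>z0 \<in> U\<close> holomorphic_derivI by blast
    moreover have "(q has_field_derivative deriv q \<zeta>) (at ((g \<circ> p) z0))"
      unfolding gz0 using holomorphic_derivI[OF q(1)] \<zeta>1 R by auto
    ultimately have "((\<lambda>z. q ((g \<circ> p) z)) has_field_derivative deriv q \<zeta> * deriv (g \<circ> p) z0) (at z0)"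
      using DERIV_chain2 by fast
    then have "(p has_field_derivative deriv q \<zeta> * deriv (g \<circ> p) z0) (at z0)"
      by (rule has_field_derivative_transform_within_open[OF _ \<open>open U\<close> \<open>z0 \<in> U\<close>])
         (use g(2) in \<open>auto simp: U_def\<close>)
    then have "z0 * deriv p z0 = of_real m * (\<zeta> * deriv q \<zeta>)"
      using m(2) DERIV_imp_deriv by (metis mult.assoc mult.commute)
    then show False using no_contact[OF z0_less \<zeta>1 m(1) \<zeta>(2)] by simp
  qed
  \<comment> \<open>With the image inclusion, the lift \<open>g \<circ> p\<close> exists on the
    whole disc and is the required \<open>w\<close>.\<close>
  then have "\<exists>u\<in>ball 0 1. p z = q u" if "z \<in> ball 0 1" for z using that by blast
  moreover have "(g \<circ> p) holomorphic_on ball 0 1"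
    by (rule holomorphic_on_compose_gen[OF p g(1)]) (use calculation sub in blast)
  ultimately have "(g \<circ> p) holomorphic_on ball 0 1 \<and> (g \<circ> p) ` ball 0 1 \<subseteq> ball 0 1 \<and> (g \<circ> p) 0 = 0 \<and>
      (\<forall>z\<in>ball 0 1. p z = q ((g \<circ> p) z))"
    using g(2) sub pq R by (fastforce simp: image_subset_iff subset_iff)
  then show ?thesis unfolding subordinate_def using p q1 by blast
qed

text \<open>Noshiro-Warschawski argument: along the segment from \<open>s0\<close> to
  \<open>s1\<close>, positivity of \<open>Re (G' s)\<close> gives
  \<open>(G s1 - G s0) * cnj (s1 - s0)\<close> positive real part, while a difference
  \<open>c \<ge> 0\<close> would give \<open>c * Re (s1 - s0) \<le> 0\<close>.\<close>

lemma Re_deriv_pos_imp_not_shifted_right: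
  assumes G: "\<And>s. Re s \<le> 0 \<Longrightarrow> (G has_field_derivative G' s) (at s)"
    and pos: "\<And>s. Re s \<le> 0 \<Longrightarrow> Re (G' s) > 0"
    and s: "Re s0 = 0" "Re s1 < 0" and c: "(c::real) \<ge> 0"
  shows "G s1 \<noteq> G s0 + of_real c"
proof
  assume eq: "G s1 = G s0 + of_real c"
  define d where "d = s1 - s0"
  have d: "Re d < 0" using s by (simp add: d_def)
  define \<phi> where "\<phi> t = Re (G (s0 + of_real t * d) * cnj d)" for t
  have "\<phi> 0 < \<phi> 1"
  proof (rule DERIV_pos_imp_increasing[of 0 1 \<phi>])
    fix t :: real assume t: "0 \<le> t" "t \<le> 1"
    let ?s = "s0 + of_real t * d"
    have le: "Re ?s \<le> 0" using s d t by (simp add: mult_nonneg_nonpos)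
    from G[OF le] have "((\<lambda>t. G (s0 + t * d)) has_field_derivative G' ?s * d) (at (of_real t))"
      by (rule DERIV_chain2) (auto intro!: derivative_eq_intros)
    then have "((\<lambda>t. G (s0 + t * d) * cnj d) has_field_derivative G' ?s * d * cnj d) (at (of_real t))"
      by (rule DERIV_cmult_right)
    then have "((\<lambda>t. G (s0 + of_real t * d) * cnj d) has_vector_derivative G' ?s * d * cnj d) (at t)"
      by (rule has_vector_derivative_real_field)
    then have "(\<phi> has_real_derivative Re (G' ?s * d * cnj d)) (at t)"
      unfolding \<phi>_def by (rule has_field_derivative_Re)
    moreover have "Re (G' ?s * d * cnj d) = Re (G' ?s) * (norm d)\<^sup>2"
      by (simp only: mult.assoc complex_norm_square[symmetric]) simp
    moreover have "norm d > 0" using d by auto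
    ultimately show "\<exists>y. (\<phi> has_real_derivative y) (at t) \<and> y > 0"
      using pos[OF le] by (metis mult_pos_pos zero_less_power)
  qed simp
  then have "Re ((G s1 - G s0) * cnj d) > 0"
    by (simp add: \<phi>_def d_def algebra_simps)
  moreover have "Re ((G s1 - G s0) * cnj d) = c * Re d" by (simp add: eq)
  ultimately show False using mult_nonneg_nonpos[of c "Re d"] c d by linarith
qed

subsection \<open>Subordination to \<open>cosh_sqrt\<close>\<close>

text \<open>
  Starlikeness of \<open>Q z = z * q' z / q z\<close>, \<open>q = cosh_sqrt\<close>, is read in the coordinate \<open>s = ln z\<close> on the
  left half-plane: with \<open>exp (G s) = Q (exp s)\<close> and \<open>a = exp (s / 2)\<close> one has
  \<open>G' s = (1 + 2 * a / sinh (2 * a)) / 2\<close>, whose real part is positive.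
\<close>

lemma log_deriv_cosh_sqrt_starlike:
  fixes m :: real
  assumes \<zeta>: "norm \<zeta> = 1" and w: "norm w < 1" and m: "m \<ge> 1"
  shows "w * deriv cosh_sqrt w / cosh_sqrt w \<noteq> of_real m * (\<zeta> * deriv cosh_sqrt \<zeta> / cosh_sqrt \<zeta>)"
proof
  assume eq: "w * deriv cosh_sqrt w / cosh_sqrt w = of_real m * (\<zeta> * deriv cosh_sqrt \<zeta> / cosh_sqrt \<zeta>)"
  \<comment> \<open>Only the zero-free factor \<open>q' / q\<close> of \<open>Q\<close> needs a
    logarithm; the factor \<open>z = exp s\<close> contributes \<open>s\<close> to \<open>G\<close>.
    Radius 2 covers the line \<open>Re s = 0\<close>.\<close>
  obtain L where L: "L holomorphic_on ball 0 2"
    "\<And>z. z \<in> ball 0 2 \<Longrightarrow> deriv cosh_sqrt z / cosh_sqrt z = exp (L z)"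
  proof (rule contractible_imp_holomorphic_log)
    show "(\<lambda>z. deriv cosh_sqrt z / cosh_sqrt z) holomorphic_on ball 0 2"
      using cosh_sqrt_nonzero by (auto intro!: holomorphic_intros)
    show "contractible (ball (0::complex) 2)" by (simp add: convex_imp_contractible)
  qed (use cosh_sqrt_nonzero deriv_cosh_sqrt_nonzero in auto)
  define G where "G s = s + L (exp s)" for s
  define G' where "G' s = 1 + deriv L (exp s) * exp s" for s
  have exp_G: "exp (G s) = exp s * deriv cosh_sqrt (exp s) / cosh_sqrt (exp s)" if "norm (exp s) < 2" for s
    using L(2)[of "exp s", symmetric] that by (simp add: G_def exp_add del: norm_exp_eq_Re)
  have exp_G_half: "exp (G s) = exp (s / 2) * tanh (exp (s / 2)) / 2" if "norm (exp s) < 2" for s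
  proof -
    have "(exp (s / 2))\<^sup>2 = exp s" by (simp flip: exp_of_nat_mult)
    then show ?thesis
      using exp_G[OF that] log_deriv_cosh_sqrt_power2[of "exp (s / 2)"] by simp
  qed
  have in_ball: "norm (exp s) \<le> 1" if "Re s \<le> 0" for s using that by simp
  have G: "(G has_field_derivative G' s) (at s)" if "Re s \<le> 0" for s
  proof -
    have "(L has_field_derivative deriv L (exp s)) (at (exp s))"
      using holomorphic_derivI[OF L(1)] in_ball[OF that] by (simp del: norm_exp_eq_Re)
    then have "((\<lambda>s. L (exp s)) has_field_derivative deriv L (exp s) * exp s) (at s)"
      by (rule DERIV_chain2) (auto intro!: derivative_eq_intros)
    then show ?thesis unfolding G_def G'_def by (auto intro!: derivative_eq_intros)
  qed
  have G'_pos: "Re (G' s) > 0" if "Re s \<le> 0" for s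
  proof -
    define a where "a = exp (s / 2)"
    have a: "a \<noteq> 0" "norm a \<le> 1" using that by (auto simp: a_def)
    have sinh: "sinh (2 * a) \<noteq> 0" "Re (2 * a / sinh (2 * a)) > 0"
      using Re_div_sinh_pos[of "2 * a"] a by (auto simp: norm_mult)
    then have nz: "sinh a \<noteq> 0" "cosh a \<noteq> 0" by (auto simp: sinh_double)
    then have "tanh a \<noteq> 0" by (simp add: tanh_def)
    \<comment> \<open>The derivative of \<open>exp (G s)\<close> is computed twice, from
      \<open>a * tanh a / 2\<close> and by the chain rule; cancelling the nonzero
      \<open>exp (G s)\<close> isolates \<open>G' s\<close>.\<close>
    have "((\<lambda>s. exp (s / 2) * tanh (exp (s / 2)) / 2) has_field_derivative
        (a / 2 * tanh a + a * ((1 - (tanh a)\<^sup>2) * (a / 2))) / 2) (at s)"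
      using nz unfolding a_def by (auto intro!: derivative_eq_intros)
    moreover have "open {s :: complex. norm (exp s) < 2}"
      by (intro open_Collect_less continuous_intros continuous_on_exp)
    ultimately have "((\<lambda>s. exp (G s)) has_field_derivative
        (a / 2 * tanh a + a * ((1 - (tanh a)\<^sup>2) * (a / 2))) / 2) (at s)"
      by (rule has_field_derivative_transform_within_open)
         (use in_ball[OF that] in \<open>auto simp: exp_G_half simp del: norm_exp_eq_Re\<close>)
    moreover have "((\<lambda>s. exp (G s)) has_field_derivative exp (G s) * G' s) (at s)"
      using G[OF that] by (auto intro!: derivative_eq_intros)
    ultimately have "exp (G s) * G' s = (a / 2 * tanh a + a * ((1 - (tanh a)\<^sup>2) * (a / 2))) / 2"
      using DERIV_unique by blast
    moreover have "exp (G s) = a * tanh a / 2"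
      using in_ball[OF that] exp_G_half[of s] by (simp add: a_def del: norm_exp_eq_Re)
    moreover have "(a / 2 * tanh a + a * ((1 - (tanh a)\<^sup>2) * (a / 2))) / 2 =
        a * tanh a / 2 * ((1 + a * (1 - (tanh a)\<^sup>2) / tanh a) / 2)"
      using \<open>tanh a \<noteq> 0\<close> by (simp add: field_simps)
    ultimately have "a * tanh a / 2 * G' s = a * tanh a / 2 * ((1 + a * (1 - (tanh a)\<^sup>2) / tanh a) / 2)"
      by simp
    then have "G' s = (1 + a * (1 - (tanh a)\<^sup>2) / tanh a) / 2"
      using \<open>tanh a \<noteq> 0\<close> a by (simp add: eq_divide_eq mult.commute)
    also have "a * (1 - (tanh a)\<^sup>2) / tanh a = a / (sinh a * cosh a)"
    proof -
      have "1 - (tanh a)\<^sup>2 = ((cosh a)\<^sup>2 - (sinh a)\<^sup>2) / (cosh a)\<^sup>2"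
        using nz by (simp add: tanh_def power_divide diff_divide_distrib)
      then have "1 - (tanh a)\<^sup>2 = 1 / (cosh a)\<^sup>2" by (simp only: hyperbolic_pythagoras)
      then show ?thesis using nz by (simp add: tanh_def power2_eq_square)
    qed
    also have "\<dots> = 2 * a / sinh (2 * a)" by (simp add: sinh_double)
    finally have "Re (G' s) = Re ((1 + 2 * a / sinh (2 * a)) / 2)" by (rule arg_cong)
    also have "\<dots> = (1 + Re (2 * a / sinh (2 * a))) / 2"
      by (simp only: Re_divide_numeral plus_complex.sel one_complex.sel)
    finally show ?thesis
      using add_pos_pos[OF zero_less_one sinh(2)] by (simp only: half_gt_zero_iff)
  qed
  have "\<zeta> \<noteq> 0" using \<zeta> by auto
  have "w \<noteq> 0" using eq \<zeta> m \<open>\<zeta> \<noteq> 0\<close> cosh_sqrt_nonzero[of \<zeta>] deriv_cosh_sqrt_nonzero[of \<zeta>] by auto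
  have "exp (G (Ln w)) = of_real m * exp (G (Ln \<zeta>))"
    using exp_G[of "Ln w"] exp_G[of "Ln \<zeta>"] \<open>\<zeta> \<noteq> 0\<close> \<open>w \<noteq> 0\<close> \<zeta> w eq by (simp del: norm_exp_eq_Re)
  also have "\<dots> = exp (G (Ln \<zeta>) + of_real (ln m))"
    using m by (simp add: exp_add exp_of_real)
  finally obtain n :: int where n: "G (Ln w) = G (Ln \<zeta>) + of_real (ln m) + of_int (2 * n) * pi * \<i>"
    unfolding exp_eq by blast
  \<comment> \<open>The ambiguity of the logarithm is absorbed into \<open>s0\<close>:
    \<open>L (exp s)\<close> has period \<open>2 * pi * \<i>\<close>, so \<open>G\<close> shifts
    along with \<open>s\<close>.\<close>
  define s0 where "s0 = Ln \<zeta> + of_int (2 * n) * pi * \<i>"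
  have "exp s0 = exp (Ln \<zeta>)" unfolding exp_eq s0_def by blast
  then have "G (Ln w) = G s0 + of_real (ln m)" unfolding n by (simp add: G_def s0_def)
  moreover have "Re s0 = 0" using \<zeta> \<open>\<zeta> \<noteq> 0\<close> by (simp add: s0_def)
  moreover have "Re (Ln w) < 0" using w \<open>w \<noteq> 0\<close> by simp
  ultimately show False using Re_deriv_pos_imp_not_shifted_right[OF G G'_pos, of s0 "Ln w" "ln m"] m by simp
qed

text \<open>With \<open>a = csqrt \<zeta>\<close>, again of modulus 1, the quotient is
  \<open>a * tanh a / 2\<close>. This is the source of \<open>2\<close> and \<open>tanh 1\<close> in
  the hypothesis on \<open>\<eta>\<close>.\<close>

lemma norm_log_deriv_cosh_sqrt_ge:
  assumes "norm \<zeta> = 1"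
  shows "norm (\<zeta> * deriv cosh_sqrt \<zeta> / cosh_sqrt \<zeta>) \<ge> tanh 1 / 2"
  unfolding log_deriv_cosh_sqrt_power2[of "csqrt \<zeta>", unfolded power2_csqrt]
  using norm_tanh_ge[of "csqrt \<zeta>"] assms by (simp add: norm_mult norm_divide)

text \<open>At contact, division by the common value \<open>p z = cosh_sqrt \<zeta>\<close> gives an
  equation between logarithmic derivatives, the quantity that both subordinations control.\<close>

lemma subordinate_cosh_sqrtI:
  assumes p: "p holomorphic_on ball 0 1" "p 0 = 1"
    and no: "\<And>z \<zeta> m. norm z < 1 \<Longrightarrow> norm \<zeta> = 1 \<Longrightarrow> m \<ge> 1 \<Longrightarrow>
      z * deriv p z / p z \<noteq> of_real m * (\<zeta> * deriv cosh_sqrt \<zeta> / cosh_sqrt \<zeta>)"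
  shows "subordinate p cosh_sqrt"
proof (rule subordinate_if_no_boundary_contact[OF p(1) _ inj_on_cosh_sqrt])
  fix z \<zeta> m assume *: "norm z < 1" "norm \<zeta> = 1" "(m::real) \<ge> 1" "p z = cosh_sqrt \<zeta>"
  show "z * deriv p z \<noteq> of_real m * (\<zeta> * deriv cosh_sqrt \<zeta>)"
    using no[OF *(1-3)] *(4) by auto
qed (use p(2) holomorphic_cosh_sqrt in auto)

theorem theorem3p1:
  fixes A B \<eta> :: complex and p :: "complex \<Rightarrow> complex"
  assumes "A \<noteq> B"
    and "norm B < 1"
    and "norm \<eta> \<ge> 2 * norm (A - B) / ((1 - norm B) * tanh 1)"
    and "p holomorphic_on \<D>"
    and "p 0 = 1"
    and "(\<lambda>z. 1 + \<eta> * (z * deriv p z / p z)) \<prec> (\<lambda>z. (1 + A * z) / (1 + B * z))"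
  shows "p \<prec> cosh_sqrt \<and>
    best_dominant
      (diff_subordination \<eta> (\<lambda>z. 1 + \<eta> * (z * deriv cosh_sqrt z / cosh_sqrt z)))
      cosh_sqrt"
proof
  have "norm (A - B) > 0" using assms(1) by simp
  moreover have "tanh 1 > (0::real)" by simp
  ultimately have "norm \<eta> > 0"
    using assms(2,3) by (smt (verit) divide_pos_pos mult_pos_pos)
  then have \<eta>: "\<eta> \<noteq> 0" by auto
  show "subordinate p cosh_sqrt"
  proof (rule subordinate_cosh_sqrtI[OF assms(4,5)])
    fix z \<zeta> :: complex and m :: real assume z: "norm z < 1" and \<zeta>: "norm \<zeta> = 1" and m: "m \<ge> 1"
    obtain w where w: "norm w < 1" "1 + \<eta> * (z * deriv p z / p z) = (1 + A * w) / (1 + B * w)"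
      using assms(6) z unfolding subordinate_def by force
    \<comment> \<open>\<open>(1 + A * w) / (1 + B * w) - 1 = (A - B) * w / (1 + B * w)\<close> has
      modulus below \<open>norm (A - B) / (1 - norm B)\<close>, strictly because
      \<open>norm w < 1\<close>; this is at most \<open>norm \<eta> * tanh 1 / 2\<close>.\<close>
    have "norm (B * w) \<le> norm B" using w(1) by (simp add: norm_mult mult_left_le)
    then have den: "norm (1 + B * w) \<ge> 1 - norm B"
      using norm_triangle_ineq2[of 1 "- (B * w)"] by simp
    then have "1 + B * w \<noteq> 0" using assms(2) by auto
    then have "\<eta> * (z * deriv p z / p z) = (A - B) * w / (1 + B * w)"
      using w(2) by (simp add: field_simps)
    then have "norm \<eta> * norm (z * deriv p z / p z) = norm (A - B) * norm w / norm (1 + B * w)"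
      by (metis norm_mult norm_divide)
    also have "\<dots> \<le> norm (A - B) * norm w / (1 - norm B)"
      using den assms(2) \<open>1 + B * w \<noteq> 0\<close> by (intro divide_left_mono) auto
    also have "\<dots> < norm (A - B) / (1 - norm B)"
      using w(1) assms(2) \<open>norm (A - B) > 0\<close> by (simp add: divide_strict_right_mono)
    also have "\<dots> = 2 * norm (A - B) / ((1 - norm B) * tanh 1) * (tanh 1 / 2)"
      using assms(2) by (simp add: divide_simps)
    also have "\<dots> \<le> norm \<eta> * (tanh 1 / 2)"
      using assms(3) by (intro mult_right_mono) auto
    finally have "norm (z * deriv p z / p z) < tanh 1 / 2"
      using \<open>norm \<eta> > 0\<close> by (simp only: mult_less_cancel_left_pos)
    also have "\<dots> \<le> norm (\<zeta> * deriv cosh_sqrt \<zeta> / cosh_sqrt \<zeta>)"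
      by (rule norm_log_deriv_cosh_sqrt_ge[OF \<zeta>])
    also have "\<dots> \<le> norm (of_real m * (\<zeta> * deriv cosh_sqrt \<zeta> / cosh_sqrt \<zeta>))"
      using m mult_right_mono[of 1 m] by (simp only: norm_mult norm_of_real) simp
    finally show "z * deriv p z / p z \<noteq> of_real m * (\<zeta> * deriv cosh_sqrt \<zeta> / cosh_sqrt \<zeta>)"
      by auto
  qed
  let ?h = "\<lambda>z. 1 + \<eta> * (z * deriv cosh_sqrt z / cosh_sqrt z)"
  have "subordinate r cosh_sqrt" if r: "diff_subordination \<eta> ?h r" for r
  proof (rule subordinate_cosh_sqrtI)
    fix z \<zeta> :: complex and m :: real assume z: "norm z < 1" and \<zeta>: "norm \<zeta> = 1" and m: "m \<ge> 1"
    obtain w where w: "norm w < 1" "1 + \<eta> * (z * deriv r z / r z) = ?h w"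
      using r z unfolding diff_subordination_def subordinate_def by force
    \<comment> \<open>Cancelling \<open>\<eta>\<close> leaves a value of \<open>Q\<close> in the
      open disc, so starlikeness applies.\<close>
    then have "z * deriv r z / r z = w * deriv cosh_sqrt w / cosh_sqrt w"
      using \<eta> by (metis add_left_cancel mult_left_cancel)
    then show "z * deriv r z / r z \<noteq> of_real m * (\<zeta> * deriv cosh_sqrt \<zeta> / cosh_sqrt \<zeta>)"
      using log_deriv_cosh_sqrt_starlike[OF \<zeta> w(1) m] by simp
  qed (use r in \<open>auto simp: diff_subordination_def\<close>)
  then have "dominant (diff_subordination \<eta> ?h) cosh_sqrt"
    by (simp add: dominant_def univalent_cosh_sqrt)
  \<comment> \<open>Since \<open>cosh_sqrt\<close> is itself a solution, it is subordinate to every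
    dominant.\<close>
  moreover have "diff_subordination \<eta> ?h cosh_sqrt"
  proof -
    have "?h holomorphic_on ball 0 1"
      using cosh_sqrt_nonzero by (auto intro!: holomorphic_intros)
    then have "subordinate ?h ?h"
      unfolding subordinate_def by (intro conjI exI[of _ "\<lambda>z. z"]) auto
    then show ?thesis by (simp add: diff_subordination_def holomorphic_cosh_sqrt)
  qed
  ultimately show "best_dominant (diff_subordination \<eta> ?h) cosh_sqrt"
    by (auto simp: best_dominant_def dominant_def)
qed

end
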